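(* Let $\Bbbk$ be a field and write $[r] = \{1,\dots,r\}$. (a) Let $k \ge 3$ be an odd integer, let $l \ne m$ be elements of $[k]$, and let $R = \Bbbk[x_1,\dots,x_k,y_1,\dots,y_{k+1}]$. Let $G_1 = \{x_ix_j \mid i \ne j \in [k]\} \setminus \{x_lx_m\}$, let $G_2 = \{y_iy_j \mid i \neq j \in [k+1]\}$, and let $G_3$ be any subset of $\{y_i x_l x_m \mid i \in [k+1]\}$ with $\#G_3 = \frac{k+1}{2}$. Then the ideal $I = \langle G_1 \cup G_2 \cup G_3\rangle$ of $R$ is an $f$-ideal. (b) Let $k \ge 4$ be an even integer, let $l \ne m$ be elements of $[k+2]$, and let $R = \Bbbk[x_1,\dots,x_k,y_1,\dots,y_{k+2}]$. Let $G_1 = \{x_ix_j \mid i \ne j \in [k]\}$, let $G_2 = \{y_iy_j \mid i \neq j \in [k+2]\} \setminus \{y_ly_m\}$, and let $G_3$ be any subset of $\{x_i y_l y_m \mid i \in [k]\}$ with $\#G_3 = \frac{k}{2}$. Then the ideal $I = \langle G_1 \cup G_2 \cup G_3\rangle$ of $R$ is an $f$-ideal.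
   Context: Let $I$ be a squarefree monomial ideal, in a polynomial ring over $\Bbbk$ with finite set of variables $V$, whose minimal monomial generators all have degree at least 2. Identify a subset $F \subseteq V$ with the squarefree monomial $x_F$ that is the product of the variables in $F$. The Stanley-Reisner complex $\Delta_I$ is the simplicial complex whose faces are the sets $F$ with $x_F \notin I$. The facet complex $\Delta(I)$ is the simplicial complex whose facets are the sets $F$ such that $x_F$ is a minimal generator of $I$; that is, its faces are the sets $F$ such that $x_F$ divides some minimal generator of $I$. The $f$-vector of a simplicial complex of dimension $e$ is $(f_{-1},f_0,\dots,f_e)$, where $f_i$ is the number of faces with $i+1$ elements ($f_{-1}=1$ for a nonempty complex). The ideal $I$ is called an $f$-ideal if $\Delta_I$ and $\Delta(I)$ have the same $f$-vector. *)

theory Defs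
  imports
    "HOL-Algebra.Ideal"
    "HOL-Algebra.Divisibility"
    "HOL-Library.Poly_Mapping"
begin

section \<open>Polynomial rings with variables in a set\<close>

text \<open>
  Exponents are finitely supported maps from variables to \<^typ>\<open>nat\<close>; a polynomial is a finitely
  supported map from exponents to coefficients, with the convolution product of
  \<^theory>\<open>HOL-Library.Poly_Mapping\<close>. The ring with variable set \<open>V\<close> consists of the polynomials
  whose exponents are supported in \<open>V\<close>.
\<close>

type_synonym ('v, 'a) mpoly = "('v \<Rightarrow>\<^sub>0 nat) \<Rightarrow>\<^sub>0 'a"

definition mpoly_ring :: "'v set \<Rightarrow> ('v, 'a::field) mpoly ring" where
  "mpoly_ring V = \<lparr>carrier = {p. \<forall>t\<in>Poly_Mapping.keys p. Poly_Mapping.keys t \<subseteq> V},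
     monoid.mult = (*), one = 1, zero = 0, add = (+)\<rparr>"

definition indet :: "'v \<Rightarrow> ('v, 'a::field) mpoly" where
  "indet v = Poly_Mapping.single (Poly_Mapping.single v 1) 1"

definition monomials :: "'v set \<Rightarrow> ('v, 'a::field) mpoly set" where
  "monomials V = {Poly_Mapping.single t 1 | t. Poly_Mapping.keys t \<subseteq> V}"

text \<open>The squarefree monomial \<open>x\<^sub>F\<close>.\<close>

definition sqfree_monomial :: "'v set \<Rightarrow> ('v, 'a::field) mpoly" where
  "sqfree_monomial F = (\<Prod>v\<in>F. indet v)"

lemma mpoly_ring_simps [simp]:
  "carrier (mpoly_ring V) = {p. \<forall>t\<in>Poly_Mapping.keys p. Poly_Mapping.keys t \<subseteq> V}"
  "p \<otimes>\<^bsub>mpoly_ring V\<^esub> q = p * q"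
  "p \<oplus>\<^bsub>mpoly_ring V\<^esub> q = p + q"
  "\<one>\<^bsub>mpoly_ring V\<^esub> = 1"
  "\<zero>\<^bsub>mpoly_ring V\<^esub> = 0"
  by (simp_all add: mpoly_ring_def)

lemma mpoly_mult_closed:
  assumes "\<forall>t\<in>Poly_Mapping.keys p. Poly_Mapping.keys t \<subseteq> V" "\<forall>t\<in>Poly_Mapping.keys q. Poly_Mapping.keys t \<subseteq> V" "t \<in> Poly_Mapping.keys (p * q)"
  shows "Poly_Mapping.keys t \<subseteq> V"
proof -
  obtain a b where "t = a + b" "a \<in> Poly_Mapping.keys p" "b \<in> Poly_Mapping.keys q"
    using keys_mult[of p q] assms(3) by blast
  then show ?thesis
    using keys_add[of a b] assms(1,2) by blast
qed

lemma mpoly_add_closed: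
  assumes "\<forall>t\<in>Poly_Mapping.keys p. P t" "\<forall>t\<in>Poly_Mapping.keys q. P t" "t \<in> Poly_Mapping.keys (p + q)"
  shows "P t"
  using keys_add[of p q] assms by blast

lemma cring_mpoly_ring: "cring (mpoly_ring V :: ('v, 'a::field) mpoly ring)" (is "cring ?R")
proof (rule cringI)
  show "abelian_group ?R"
  proof (rule abelian_groupI)
    fix p q assume "p \<in> carrier ?R" "q \<in> carrier ?R"
    then show "p \<oplus>\<^bsub>?R\<^esub> q \<in> carrier ?R"
      using mpoly_add_closed[of p "\<lambda>t. Poly_Mapping.keys t \<subseteq> V" q] by simp
  next
    fix p assume "p \<in> carrier ?R"
    then show "\<exists>q\<in>carrier ?R. q \<oplus>\<^bsub>?R\<^esub> p = \<zero>\<^bsub>?R\<^esub>"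
      by (intro bexI[of _ "- p"]) auto
  qed (simp_all add: ac_simps)
  show "comm_monoid ?R"
  proof (rule comm_monoidI)
    fix p q assume "p \<in> carrier ?R" "q \<in> carrier ?R"
    then show "p \<otimes>\<^bsub>?R\<^esub> q \<in> carrier ?R"
      using mpoly_mult_closed[of p V q] by simp
  qed (simp_all add: ac_simps)
qed (simp add: distrib_right)


section \<open>Minimal monomial generators\<close>

text \<open>
  The minimal generators of a monomial ideal are the monomials in it that are minimal with respect
  to divisibility; \<open>minimal_generators_unique\<close> below shows that they form the unique irredundant
  set of monomials that generates the ideal.
\<close>

definition minimal_generators :: "'v set \<Rightarrow> ('v, 'a::field) mpoly set \<Rightarrow> ('v, 'a) mpoly set" where
  "minimal_generators V I =
     {m \<in> monomials V \<inter> I. \<forall>n \<in> monomials V \<inter> I. n divides\<^bsub>mpoly_ring V\<^esub> m \<longrightarrow> n = m}"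

lemma monomial_divides_iff:
  assumes "Poly_Mapping.keys t \<subseteq> V"
  shows "(Poly_Mapping.single s 1 :: ('v, 'a::field) mpoly) divides\<^bsub>mpoly_ring V\<^esub>
           Poly_Mapping.single t 1 \<longleftrightarrow> (\<exists>u. t = s + u)" (is "?l \<longleftrightarrow> ?r")
proof
  assume ?l
  then obtain q :: "('v, 'a) mpoly" where
    q: "Poly_Mapping.single t 1 = Poly_Mapping.single s 1 * q"
    by (auto simp: factor_def)
  have "t \<in> Poly_Mapping.keys (Poly_Mapping.single s 1 * q)"
    by (subst q[symmetric]) simp
  then show ?r
    using keys_mult[of "Poly_Mapping.single s 1" q] by auto
next
  assume ?r
  then obtain u where u: "t = s + u" ..
  have "Poly_Mapping.keys u \<subseteq> V"
    using assms u by (auto simp: in_keys_iff lookup_add)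
  then show ?l
    by (auto simp: factor_def u mult_single intro!: exI[of _ "Poly_Mapping.single u 1"])
qed

lemma mem_monomial_ideal_iff:
  assumes T: "\<And>t. t \<in> T \<Longrightarrow> Poly_Mapping.keys t \<subseteq> V"
  shows "(p :: ('v, 'a::field) mpoly) \<in> Idl\<^bsub>mpoly_ring V\<^esub> ((\<lambda>t. Poly_Mapping.single t 1) ` T) \<longleftrightarrow>
           p \<in> carrier (mpoly_ring V) \<and> (\<forall>t\<in>Poly_Mapping.keys p. \<exists>s\<in>T. \<exists>u. t = s + u)"
    (is "p \<in> Idl\<^bsub>?R\<^esub> ?M \<longleftrightarrow> _ \<and> ?P p")
proof -
  interpret cring "?R :: ('v, 'a) mpoly ring"
    by (rule cring_mpoly_ring)
  have M: "?M \<subseteq> carrier ?R"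
    using T by fastforce
  interpret I: ideal "Idl\<^bsub>?R\<^esub> ?M" "?R :: ('v, 'a) mpoly ring"
    by (rule genideal_ideal[OF M])
  let ?J = "{q \<in> carrier ?R. ?P q} :: ('v, 'a) mpoly set"
  have mul: "?P (q * r)" if r: "?P r" for q r :: "('v, 'a) mpoly"
  proof
    fix t assume "t \<in> Poly_Mapping.keys (q * r)"
    then obtain a b where ab: "t = a + b" "b \<in> Poly_Mapping.keys r"
      using keys_mult[of q r] by blast
    then obtain s u where "s \<in> T" "b = s + u"
      using r by blast
    then show "\<exists>s\<in>T. \<exists>u. t = s + u"
      using ab by (auto intro!: bexI[of _ s] exI[of _ "a + u"] simp: ac_simps)
  qed
  have add: "?P (q + r)" if "?P q" "?P r" for q r :: "('v, 'a) mpoly"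
    using mpoly_add_closed[of q "\<lambda>t. \<exists>s\<in>T. \<exists>u. t = s + u" r] that by blast
  have inv: "\<ominus>\<^bsub>?R\<^esub> q = - q" if "q \<in> carrier ?R" for q :: "('v, 'a) mpoly"
  proof -
    have "(- q) \<in> carrier ?R" "(- q) \<oplus>\<^bsub>?R\<^esub> q = \<zero>\<^bsub>?R\<^esub>"
      using that by simp_all
    then show ?thesis
      using minus_equality that by blast
  qed
  have "ideal ?J ?R"
  proof (rule idealI[OF ring_axioms])
    show "subgroup ?J (add_monoid ?R)"
    proof (rule add.subgroupI)
      show "?J \<subseteq> carrier ?R" by blast
      show "?J \<noteq> {}" by (auto intro!: exI[of _ 0])
    next
      fix q assume "q \<in> ?J"
      then show "\<ominus>\<^bsub>?R\<^esub> q \<in> ?J"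
        using inv[of q] by simp
    next
      fix q r assume "q \<in> ?J" "r \<in> ?J"
      then show "q \<oplus>\<^bsub>?R\<^esub> r \<in> ?J"
        using add.m_closed[of q r] add[of q r] by simp
    qed
  next
    fix q r assume "q \<in> ?J" "r \<in> carrier ?R"
    then show "r \<otimes>\<^bsub>?R\<^esub> q \<in> ?J" "q \<otimes>\<^bsub>?R\<^esub> r \<in> ?J"
      using m_closed[of r q] mul[of q r] by (simp_all add: mult.commute)
  qed
  moreover have "?M \<subseteq> ?J"
    using M by (auto intro!: bexI exI[of _ 0])
  ultimately have "Idl\<^bsub>?R\<^esub> ?M \<subseteq> ?J"
    by (rule genideal_minimal)
  moreover have "p \<in> Idl\<^bsub>?R\<^esub> ?M" if p: "p \<in> carrier ?R" "?P p"
  proof -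
    have term_mem: "Poly_Mapping.single t (Poly_Mapping.lookup p t) \<in> Idl\<^bsub>?R\<^esub> ?M" if t: "t \<in> Poly_Mapping.keys p" for t
    proof -
      obtain s u where su: "s \<in> T" "t = s + u"
        using p t by blast
      have "Poly_Mapping.keys t \<subseteq> V"
        using p t by simp
      then have "Poly_Mapping.keys u \<subseteq> V"
        unfolding su by (auto simp: in_keys_iff lookup_add)
      then have "Poly_Mapping.single u (Poly_Mapping.lookup p t) \<in> carrier ?R"
        by simp
      moreover have "Poly_Mapping.single s 1 \<in> Idl\<^bsub>?R\<^esub> ?M"
        using genideal_self[OF M] su by blast
      ultimately have "Poly_Mapping.single u (Poly_Mapping.lookup p t) \<otimes>\<^bsub>?R\<^esub> Poly_Mapping.single s 1
          \<in> Idl\<^bsub>?R\<^esub> ?M"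
        using I.I_l_closed by blast
      then show ?thesis
        by (simp add: mult_single su add.commute)
    qed
    have sum_mem: "(\<Sum>t\<in>A. Poly_Mapping.single t (Poly_Mapping.lookup p t)) \<in> Idl\<^bsub>?R\<^esub> ?M"
      if "finite A" "A \<subseteq> Poly_Mapping.keys p" for A
      using that
    proof (induction A)
      case empty
      then show ?case
        using I.zero_closed by simp
    next
      case (insert t A)
      then show ?case
        using I.a_closed[of "Poly_Mapping.single t (Poly_Mapping.lookup p t)"] term_mem by simp
    qed
    have "(\<Sum>t\<in>Poly_Mapping.keys p. Poly_Mapping.single t (Poly_Mapping.lookup p t)) = p"
      by (intro poly_mapping_eqI)
        (simp add: lookup_sum lookup_single when_def in_keys_iff)
    then show ?thesis
      using sum_mem[of "Poly_Mapping.keys p"] by simp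
  qed
  ultimately show ?thesis
    by blast
qed

lemma minimal_generators_unique:
  fixes M :: "('v, 'a::field) mpoly set"
  assumes M: "M \<subseteq> monomials V" and I: "I = Idl\<^bsub>mpoly_ring V\<^esub> M"
  shows "G \<subseteq> monomials V \<and> Idl\<^bsub>mpoly_ring V\<^esub> G = I \<and> (\<forall>H. H \<subset> G \<longrightarrow> Idl\<^bsub>mpoly_ring V\<^esub> H \<noteq> I) \<longleftrightarrow>
           G = minimal_generators V I"
proof -
  let ?R = "mpoly_ring V :: ('v, 'a) mpoly ring"
  let ?mon = "\<lambda>t. Poly_Mapping.single t 1 :: ('v, 'a) mpoly"
  define K where "K = {t :: 'v \<Rightarrow>\<^sub>0 nat. Poly_Mapping.keys t \<subseteq> V}"
  define dv where "dv s t \<longleftrightarrow> (\<exists>u. t = s + u)" for s t :: "'v \<Rightarrow>\<^sub>0 nat"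
  define E where "E = {t \<in> K. ?mon t \<in> I}"
  define N where "N = {t \<in> E. \<forall>s\<in>E. dv s t \<longrightarrow> s = t}"
  have mons: "monomials V = ?mon ` K"
    by (auto simp: monomials_def K_def)
  have inj: "inj ?mon"
    by (auto simp: inj_def dest!: arg_cong[of _ _ Poly_Mapping.keys])
  have subK: "\<exists>S\<subseteq>K. H = ?mon ` S" if "H \<subseteq> monomials V" for H
    using that unfolding mons by (simp add: subset_image_iff)
  have dv_refl: "dv t t" for t
    unfolding dv_def by (rule exI[of _ 0]) simp
  have dv_trans: "dv r t" if "dv r s" "dv s t" for r s t
    using that unfolding dv_def by (metis add.assoc)
  have mem: "p \<in> Idl\<^bsub>?R\<^esub> (?mon ` S) \<longleftrightarrow>
      p \<in> carrier ?R \<and> (\<forall>t\<in>Poly_Mapping.keys p. \<exists>s\<in>S. dv s t)" if "S \<subseteq> K" for S p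
    unfolding dv_def by (rule mem_monomial_ideal_iff) (use that in \<open>auto simp: K_def\<close>)
  obtain T where T: "T \<subseteq> K" "M = ?mon ` T"
    using subK[OF M] by blast
  have E: "t \<in> E \<longleftrightarrow> t \<in> K \<and> (\<exists>s\<in>T. dv s t)" for t
    unfolding E_def I T(2) mem[OF T(1)] by (auto simp: K_def)
  have Idl_eq: "Idl\<^bsub>?R\<^esub> (?mon ` S) = I \<longleftrightarrow> S \<subseteq> E \<and> (\<forall>t\<in>E. \<exists>s\<in>S. dv s t)" if S: "S \<subseteq> K" for S
  proof
    assume eq: "Idl\<^bsub>?R\<^esub> (?mon ` S) = I"
    have "t \<in> E \<longleftrightarrow> t \<in> K \<and> (\<exists>s\<in>S. dv s t)" for t
      unfolding E_def eq[symmetric] mem[OF S] by (auto simp: K_def)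
    then show "S \<subseteq> E \<and> (\<forall>t\<in>E. \<exists>s\<in>S. dv s t)"
      using S dv_refl by blast
  next
    assume a: "S \<subseteq> E \<and> (\<forall>t\<in>E. \<exists>s\<in>S. dv s t)"
    have "(\<exists>s\<in>S. dv s t) \<longleftrightarrow> (\<exists>s\<in>T. dv s t)" if "t \<in> K" for t
      using a E that dv_trans by blast
    then show "Idl\<^bsub>?R\<^esub> (?mon ` S) = I"
      unfolding I T(2) set_eq_iff mem[OF S] mem[OF T(1)] by (auto simp: K_def)
  qed
  have dominated: "\<exists>s\<in>N. dv s t" if t: "t \<in> E" for t
  proof -
    define d where "d s = (\<Sum>v\<in>Poly_Mapping.keys t. Poly_Mapping.lookup s v)"
      for s :: "'v \<Rightarrow>\<^sub>0 nat"
    obtain s where s: "s \<in> E" "dv s t" and least: "\<And>r. r \<in> E \<Longrightarrow> dv r t \<Longrightarrow> d s \<le> d r"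
      using ex_has_least_nat[of "\<lambda>s. s \<in> E \<and> dv s t" t d] t dv_refl by blast
    have "r = s" if r: "r \<in> E" "dv r s" for r
    proof -
      obtain u where u: "s = r + u"
        using r dv_def by blast
      have "d s = d r + d u"
        by (simp add: d_def u lookup_add sum.distrib)
      moreover have "d s \<le> d r"
        using least r s dv_trans by blast
      ultimately have "d u = 0"
        by simp
      then have z: "Poly_Mapping.lookup u v = 0" if "v \<in> Poly_Mapping.keys t" for v
        using that by (simp add: d_def)
      have "Poly_Mapping.lookup u v = 0" if "v \<notin> Poly_Mapping.keys t" for v
        using that s(2) by (auto simp: dv_def u lookup_add in_keys_iff)
      then have "u = 0"
        using z by (intro poly_mapping_eqI) auto
      then show ?thesis
        using u by simp
    qed
    then show ?thesis
      using s by (auto simp: N_def)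
  qed
  have mg: "minimal_generators V I = ?mon ` N"
  proof -
    have MI: "monomials V \<inter> I = ?mon ` E"
      by (auto simp: mons E_def)
    have dvd: "?mon s divides\<^bsub>?R\<^esub> ?mon t \<longleftrightarrow> dv s t" if "t \<in> E" for s t
      unfolding dv_def by (rule monomial_divides_iff) (use that in \<open>simp add: E_def K_def\<close>)
    have "(\<forall>n\<in>?mon ` E. n divides\<^bsub>?R\<^esub> ?mon t \<longrightarrow> n = ?mon t) \<longleftrightarrow> t \<in> N" if t: "t \<in> E" for t
      unfolding ball_simps dvd[OF t] inj_eq[OF inj] using t by (simp add: N_def)
    then show ?thesis
      unfolding minimal_generators_def MI by (auto simp: N_def)
  qed
  have NE: "N \<subseteq> E" "E \<subseteq> K"
    by (auto simp: N_def E_def)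
  have Idl_N: "Idl\<^bsub>?R\<^esub> (?mon ` N) = I"
    using Idl_eq[of N] NE dominated by blast
  show ?thesis
  proof
    assume G: "G \<subseteq> monomials V \<and> Idl\<^bsub>?R\<^esub> G = I \<and> (\<forall>H. H \<subset> G \<longrightarrow> Idl\<^bsub>?R\<^esub> H \<noteq> I)"
    then have GK: "G \<subseteq> monomials V" and GI: "Idl\<^bsub>?R\<^esub> G = I"
      and irr: "\<And>H. H \<subset> G \<Longrightarrow> Idl\<^bsub>?R\<^esub> H \<noteq> I"
      by simp_all
    obtain S where S: "S \<subseteq> K" "G = ?mon ` S"
      using subK[OF GK] by blast
    have dom: "S \<subseteq> E" "\<forall>t\<in>E. \<exists>s\<in>S. dv s t"
      using Idl_eq[OF S(1)] GI unfolding S(2) by simp_all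
    have "N \<subseteq> S"
    proof
      fix t assume t: "t \<in> N"
      then obtain s where "s \<in> S" "dv s t" "s \<in> E"
        using dom NE by blast
      then show "t \<in> S"
        using t by (auto simp: N_def)
    qed
    have "?mon ` N \<subseteq> G"
      unfolding S(2) using \<open>N \<subseteq> S\<close> by (rule image_mono)
    moreover have "\<not> ?mon ` N \<subset> G"
      using irr[of "?mon ` N"] Idl_N by blast
    ultimately show "G = minimal_generators V I"
      unfolding mg by (simp add: psubset_eq)
  next
    assume G: "G = minimal_generators V I"
    have "Idl\<^bsub>?R\<^esub> H \<noteq> I" if H: "H \<subset> G" for H
    proof
      assume eq: "Idl\<^bsub>?R\<^esub> H = I"
      have "H \<subseteq> ?mon ` N"
        using H unfolding G mg by (rule psubset_imp_subset)
      then obtain S where S: "S \<subseteq> N" "H = ?mon ` S"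
        by (rule subset_imageE)
      have "S \<noteq> N"
        using H unfolding G mg S(2) by auto
      then obtain t where t: "t \<in> N" "t \<notin> S"
        using S(1) by auto
      have "S \<subseteq> K"
        using S(1) NE by simp
      then have "\<forall>t\<in>E. \<exists>s\<in>S. dv s t"
        using Idl_eq[of S] eq unfolding S(2) by simp
      then obtain s where "s \<in> S" "dv s t"
        using t NE by blast
      then show False
        using t S(1) by (auto simp: N_def)
    qed
    moreover have "G \<subseteq> monomials V"
      using NE unfolding G mg mons by (intro image_mono) simp
    moreover have "Idl\<^bsub>?R\<^esub> G = I"
      unfolding G mg by (rule Idl_N)
    ultimately show "G \<subseteq> monomials V \<and> Idl\<^bsub>?R\<^esub> G = I \<and> (\<forall>H. H \<subset> G \<longrightarrow> Idl\<^bsub>?R\<^esub> H \<noteq> I)"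
      by simp
  qed
qed


section \<open>f-ideals\<close>

definition squarefree_monomial_ideal :: "'v set \<Rightarrow> ('v, 'a::field) mpoly set \<Rightarrow> bool" where
  "squarefree_monomial_ideal V I \<longleftrightarrow>
     (\<exists>A \<subseteq> Pow V. I = Idl\<^bsub>mpoly_ring V\<^esub> (sqfree_monomial ` A))"

text \<open>Total degree, with the convention that the zero polynomial has degree 0.\<close>

definition total_degree :: "('v, 'a::field) mpoly \<Rightarrow> nat" where
  "total_degree p = Max (insert 0
     ((\<lambda>t. \<Sum>v\<in>Poly_Mapping.keys t. Poly_Mapping.lookup t v) ` Poly_Mapping.keys p))"

text \<open>Simplicial complexes are represented by their sets of faces (including the empty face).\<close>

definition stanley_reisner_complex :: "'v set \<Rightarrow> ('v, 'a::field) mpoly set \<Rightarrow> 'v set set" where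
  "stanley_reisner_complex V I = {F. F \<subseteq> V \<and> sqfree_monomial F \<notin> I}"

definition facet_complex :: "'v set \<Rightarrow> ('v, 'a::field) mpoly set \<Rightarrow> 'v set set" where
  "facet_complex V I =
     {F. F \<subseteq> V \<and> (\<exists>m\<in>minimal_generators V I. sqfree_monomial F divides\<^bsub>mpoly_ring V\<^esub> m)}"

text \<open>
  The list \<open>[f\<^sub>-\<^sub>1, f\<^sub>0, \<dots>, f\<^sub>e]\<close>, where \<open>e\<close> is the dimension, i.e. \<open>e + 1\<close> is the maximal size of a
  face; so the entry at position \<open>i\<close> counts the faces with \<open>i\<close> elements. The complex without
  faces gets the empty list.
\<close>

definition f_vector :: "'v set set \<Rightarrow> nat list" where
  "f_vector \<Delta> = (if \<Delta> = {} then []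
     else map (\<lambda>i. card {F \<in> \<Delta>. card F = i}) [0..<Suc (Max (card ` \<Delta>))])"

definition f_ideal :: "'v set \<Rightarrow> ('v, 'a::field) mpoly set \<Rightarrow> bool" where
  "f_ideal V I \<longleftrightarrow>
     finite V \<and> squarefree_monomial_ideal V I \<and>
     (\<forall>m\<in>minimal_generators V I. 2 \<le> total_degree m) \<and>
     f_vector (stanley_reisner_complex V I) = f_vector (facet_complex V I)"


section \<open>Variables \<open>x\<^sub>i\<close> and \<open>y\<^sub>i\<close>\<close>

datatype xy_var = X nat | Y nat

abbreviation x :: "nat \<Rightarrow> (xy_var, 'a::field) mpoly" where
  "x i \<equiv> indet (X i)"

abbreviation y :: "nat \<Rightarrow> (xy_var, 'a::field) mpoly" where
  "y i \<equiv> indet (Y i)"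

end

theory Submission
  imports Defs
begin

text \<open>
  Both parts describe one construction. Take disjoint finite sets \<open>A\<close> and \<open>B\<close> of variables, distinct
  \<open>a, b \<in> A\<close> and a subset \<open>C \<subseteq> B\<close>; the generators correspond to the pairs inside \<open>A\<close> other than
  \<open>{a, b}\<close>, the pairs inside \<open>B\<close>, and the triples \<open>{c, a, b}\<close> with \<open>c \<in> C\<close>. Since these sets form an
  antichain, they are the facets of the facet complex, while the faces of the Stanley-Reisner
  complex are the sets of variables containing none of them (\<open>f_ideal_if_card_eq\<close>). This turns the
  claim into a count of sets by size.

  Both complexes contain the empty set and all singletons, and nothing with more than three elements.
  In size 3 the Stanley-Reisner complex has the triples \<open>{d, a, b}\<close> with \<open>d \<in> B - C\<close>, and the facet
  complex those with \<open>d \<in> C\<close>; the numbers agree when \<open>C\<close> is half of \<open>B\<close>. In size 2 the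
  Stanley-Reisner complex has the \<open>|A| |B|\<close> mixed pairs and \<open>{a, b}\<close>; the facet complex has all the
  pairs inside \<open>A\<close> or inside \<open>B\<close>, the pair \<open>{a, b}\<close> being recovered from a triple, and the \<open>2 |C|\<close>
  mixed pairs \<open>{c, a}\<close> and \<open>{c, b}\<close>. With \<open>2 |C| = |B|\<close> and \<open>d = |A| - |B|\<close>, equality of the two
  numbers amounts to \<open>d (d - 1) = 2\<close>, so \<open>d = -1\<close> or \<open>d = 2\<close>. The first solution is part (a),
  where the \<open>x\<^sub>i\<close> form \<open>A\<close>; the second is part (b), where the \<open>y\<^sub>i\<close> do.
\<close>

section \<open>Squarefree monomial ideals as set systems\<close>

lemma f_vector_cong:
  fixes \<Delta> \<Gamma> :: "'v set set"
  assumes fin: "finite \<Delta>" "finite \<Gamma>"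
    and eq: "\<And>i. card {F \<in> \<Delta>. card F = i} = card {F \<in> \<Gamma>. card F = i}"
  shows "f_vector \<Delta> = f_vector \<Gamma>"
proof -
  \<comment> \<open>A size occurs in a finite complex iff its count is nonzero, so the counts determine the length
    of the list too.\<close>
  have sizes: "card ` \<Theta> = {i. card {F \<in> \<Theta>. card F = i} \<noteq> 0}" if "finite \<Theta>" for \<Theta> :: "'v set set"
    using that by (auto simp: card_eq_0_iff)
  have im: "card ` \<Delta> = card ` \<Gamma>"
    unfolding sizes[OF fin(1)] sizes[OF fin(2)] eq ..
  then have "\<Delta> = {} \<longleftrightarrow> \<Gamma> = {}"
    by (metis image_is_empty)
  then show ?thesis
    unfolding f_vector_def im eq by simp
qed

definition sqfree_exponent :: "'v set \<Rightarrow> 'v \<Rightarrow>\<^sub>0 nat" where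
  "sqfree_exponent F = (\<Sum>v\<in>F. Poly_Mapping.single v 1)"

lemma lookup_sqfree_exponent:
  "finite F \<Longrightarrow> Poly_Mapping.lookup (sqfree_exponent F) v = (if v \<in> F then 1 else 0)"
  by (simp add: sqfree_exponent_def lookup_sum lookup_single when_def)

lemma keys_sqfree_exponent: "finite F \<Longrightarrow> Poly_Mapping.keys (sqfree_exponent F) = F"
  by (auto simp: in_keys_iff lookup_sqfree_exponent split: if_splits)

lemma sqfree_monomial_eq_single:
  "finite F \<Longrightarrow>
    (sqfree_monomial F :: ('v, 'a::field) mpoly) = Poly_Mapping.single (sqfree_exponent F) 1"
  unfolding sqfree_monomial_def sqfree_exponent_def
  by (induction F rule: finite_induct) (simp_all add: indet_def mult_single)

lemma sqfree_exponent_le_iff: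
  assumes "finite F"
  shows "(\<exists>u. t = sqfree_exponent F + u) \<longleftrightarrow> F \<subseteq> Poly_Mapping.keys t"
proof
  assume "\<exists>u. t = sqfree_exponent F + u"
  then show "F \<subseteq> Poly_Mapping.keys t"
    using assms by (auto simp: in_keys_iff lookup_add lookup_sqfree_exponent)
next
  assume sub: "F \<subseteq> Poly_Mapping.keys t"
  have "t = sqfree_exponent F + (t - sqfree_exponent F)"
  proof (rule poly_mapping_eqI)
    fix v
    show "Poly_Mapping.lookup t v = Poly_Mapping.lookup (sqfree_exponent F + (t - sqfree_exponent F)) v"
      using sub assms by (auto simp: lookup_add lookup_minus lookup_sqfree_exponent in_keys_iff)
  qed
  then show "\<exists>u. t = sqfree_exponent F + u" ..
qed

lemma sqfree_monomial_inject:
  assumes "finite F" "finite G"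
    and eq: "(sqfree_monomial F :: ('v, 'a::field) mpoly) = sqfree_monomial G"
  shows "F = G"
proof -
  have "sqfree_exponent F = sqfree_exponent G"
    using arg_cong[OF eq, of Poly_Mapping.keys] assms(1,2) by (simp add: sqfree_monomial_eq_single)
  then show ?thesis
    using assms(1,2) keys_sqfree_exponent by metis
qed

lemma total_degree_sqfree_monomial:
  assumes "finite F"
  shows "total_degree (sqfree_monomial F :: ('v, 'a::field) mpoly) = card F"
  using assms
  by (simp add: total_degree_def sqfree_monomial_eq_single keys_sqfree_exponent
      lookup_sqfree_exponent)

context
  fixes V :: "'v set" and \<E> :: "'v set set" and I :: "('v, 'a::field) mpoly set"
  assumes fin: "finite V" and sub: "\<E> \<subseteq> Pow V"
    and I: "I = Idl\<^bsub>mpoly_ring V\<^esub> (sqfree_monomial ` \<E>)"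
begin

lemma finite_subset_V: "F \<subseteq> V \<Longrightarrow> finite F"
  using fin finite_subset by blast

lemma monomial_mem_iff:
  "(Poly_Mapping.single t 1 :: ('v, 'a) mpoly) \<in> I \<longleftrightarrow>
    Poly_Mapping.keys t \<subseteq> V \<and> (\<exists>E\<in>\<E>. E \<subseteq> Poly_Mapping.keys t)"
proof -
  have finE: "finite E" if "E \<in> \<E>" for E
    using that sub finite_subset_V by blast
  have "(sqfree_monomial ` \<E> :: ('v, 'a) mpoly set)
      = (\<lambda>t. Poly_Mapping.single t 1) ` sqfree_exponent ` \<E>"
    unfolding image_image using finE by (intro image_cong) (simp_all add: sqfree_monomial_eq_single)
  moreover have "Poly_Mapping.keys s \<subseteq> V" if "s \<in> sqfree_exponent ` \<E>" for s
  proof -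
    obtain E where E: "E \<in> \<E>" "s = sqfree_exponent E"
      using \<open>s \<in> sqfree_exponent ` \<E>\<close> by blast
    then show ?thesis
      using sub finE[OF E(1)] by (auto simp: keys_sqfree_exponent)
  qed
  ultimately have "(Poly_Mapping.single t 1 :: ('v, 'a) mpoly) \<in> I \<longleftrightarrow>
      Poly_Mapping.keys t \<subseteq> V \<and> (\<exists>E\<in>\<E>. \<exists>u. t = sqfree_exponent E + u)"
    unfolding I by (simp add: mem_monomial_ideal_iff)
  moreover have "(\<exists>E\<in>\<E>. \<exists>u. t = sqfree_exponent E + u) \<longleftrightarrow> (\<exists>E\<in>\<E>. E \<subseteq> Poly_Mapping.keys t)"
    by (intro bex_cong refl sqfree_exponent_le_iff finE)
  ultimately show ?thesis
    by simp
qed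

lemma stanley_reisner_complex_eq:
  "stanley_reisner_complex V I = {F. F \<subseteq> V \<and> (\<forall>E\<in>\<E>. \<not> E \<subseteq> F)}"
proof -
  have "sqfree_monomial F \<in> I \<longleftrightarrow> (\<exists>E\<in>\<E>. E \<subseteq> F)" if "F \<subseteq> V" for F
    using that finite_subset_V[OF that]
    by (simp add: sqfree_monomial_eq_single monomial_mem_iff keys_sqfree_exponent)
  then show ?thesis
    unfolding stanley_reisner_complex_def by blast
qed

lemma minimal_generators_eq:
  assumes anti: "\<And>E F. E \<in> \<E> \<Longrightarrow> F \<in> \<E> \<Longrightarrow> E \<subseteq> F \<Longrightarrow> E = F"
  shows "minimal_generators V I = sqfree_monomial ` \<E>"
proof
  have EV: "E \<subseteq> V" "finite E" if "E \<in> \<E>" for E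
    using that sub finite_subset_V by auto
  have memE: "(sqfree_monomial E :: ('v, 'a) mpoly) \<in> monomials V \<inter> I" if "E \<in> \<E>" for E
  proof -
    have keys: "Poly_Mapping.keys (sqfree_exponent E) = E"
      and eq: "(sqfree_monomial E :: ('v, 'a) mpoly) = Poly_Mapping.single (sqfree_exponent E) 1"
      using EV[OF that] by (simp_all add: keys_sqfree_exponent sqfree_monomial_eq_single)
    have "Poly_Mapping.single (sqfree_exponent E) 1 \<in> I"
      unfolding monomial_mem_iff keys using that EV[OF that] by blast
    moreover have "Poly_Mapping.keys (sqfree_exponent E) \<subseteq> V"
      unfolding keys using EV[OF that] by blast
    ultimately show ?thesis
      unfolding eq monomials_def by blast
  qed
  show "minimal_generators V I \<subseteq> sqfree_monomial ` \<E>"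
  proof
    fix p assume p: "p \<in> minimal_generators V I"
    then obtain t where t: "p = Poly_Mapping.single t 1" "Poly_Mapping.keys t \<subseteq> V"
      by (auto simp: minimal_generators_def monomials_def)
    then obtain E where E: "E \<in> \<E>" "E \<subseteq> Poly_Mapping.keys t"
      using p by (auto simp: minimal_generators_def monomial_mem_iff)
    have "sqfree_monomial E divides\<^bsub>mpoly_ring V\<^esub> p"
      using E t EV[OF E(1)]
      by (simp add: sqfree_monomial_eq_single monomial_divides_iff sqfree_exponent_le_iff)
    then have "sqfree_monomial E = p"
      using p memE[OF E(1)] by (auto simp: minimal_generators_def)
    then show "p \<in> sqfree_monomial ` \<E>"
      using E by blast
  qed
  show "sqfree_monomial ` \<E> \<subseteq> minimal_generators V I"
  proof
    fix p :: "('v, 'a) mpoly" assume "p \<in> sqfree_monomial ` \<E>"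
    then obtain E where E: "E \<in> \<E>" and p: "p = sqfree_monomial E"
      by blast
    have "n = p" if n: "n \<in> monomials V \<inter> I" and dv: "n divides\<^bsub>mpoly_ring V\<^esub> p" for n
    proof -
      obtain s where s: "n = Poly_Mapping.single s 1" "Poly_Mapping.keys s \<subseteq> V"
        using n by (auto simp: monomials_def)
      obtain D where D: "D \<in> \<E>" "D \<subseteq> Poly_Mapping.keys s"
        using n s by (auto simp: monomial_mem_iff)
      obtain u where u: "sqfree_exponent E = s + u"
        using dv EV[OF E] unfolding p s
        by (auto simp: sqfree_monomial_eq_single monomial_divides_iff keys_sqfree_exponent)
      have look: "Poly_Mapping.lookup s v + Poly_Mapping.lookup u v = (if v \<in> E then 1 else 0)" for v
        using EV[OF E] by (simp add: lookup_sqfree_exponent flip: lookup_add u)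
      have "Poly_Mapping.keys s \<subseteq> E"
      proof
        fix v assume "v \<in> Poly_Mapping.keys s"
        then show "v \<in> E"
          using look[of v] by (auto simp: in_keys_iff split: if_splits)
      qed
      then have "D = E"
        using anti[OF D(1) E] D(2) by blast
      then have key: "v \<in> E \<Longrightarrow> Poly_Mapping.lookup s v \<noteq> 0" for v
        using D(2) by (auto simp: in_keys_iff)
      have "s = sqfree_exponent E"
      proof (rule poly_mapping_eqI)
        fix v
        show "Poly_Mapping.lookup s v = Poly_Mapping.lookup (sqfree_exponent E) v"
          using look[of v] key[of v] EV[OF E] by (auto simp: lookup_sqfree_exponent split: if_splits)
      qed
      then show ?thesis
        using EV[OF E] by (simp add: s p sqfree_monomial_eq_single)
    qed
    then show "p \<in> minimal_generators V I"
      using memE[OF E] by (simp add: minimal_generators_def p)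
  qed
qed

lemma facet_complex_eq:
  assumes "\<And>E F. E \<in> \<E> \<Longrightarrow> F \<in> \<E> \<Longrightarrow> E \<subseteq> F \<Longrightarrow> E = F"
  shows "facet_complex V I = {F. F \<subseteq> V \<and> (\<exists>E\<in>\<E>. F \<subseteq> E)}"
proof -
  have "(sqfree_monomial F :: ('v, 'a) mpoly) divides\<^bsub>mpoly_ring V\<^esub> sqfree_monomial E \<longleftrightarrow> F \<subseteq> E"
    if "F \<subseteq> V" "E \<in> \<E>" for F E
  proof -
    have "E \<subseteq> V"
      using that sub by blast
    then show ?thesis
      using that finite_subset_V[of F] finite_subset_V[of E]
      by (simp add: sqfree_monomial_eq_single monomial_divides_iff sqfree_exponent_le_iff
          keys_sqfree_exponent)
  qed
  moreover have "minimal_generators V I = sqfree_monomial ` \<E>"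
    using assms by (rule minimal_generators_eq)
  ultimately show ?thesis
    unfolding facet_complex_def by (intro Collect_cong conj_cong refl) simp
qed

text \<open>
  The antichain condition makes \<open>\<E>\<close> the set of minimal generators. What remains of the definition of
  an f-ideal then speaks of the set system \<open>\<E>\<close> alone.
\<close>

lemma f_ideal_if_card_eq:
  assumes anti: "\<And>E F. E \<in> \<E> \<Longrightarrow> F \<in> \<E> \<Longrightarrow> E \<subseteq> F \<Longrightarrow> E = F"
    and deg: "\<And>E. E \<in> \<E> \<Longrightarrow> 2 \<le> card E"
    and eq: "\<And>i. card {F. F \<subseteq> V \<and> (\<forall>E\<in>\<E>. \<not> E \<subseteq> F) \<and> card F = i}
                = card {F. F \<subseteq> V \<and> (\<exists>E\<in>\<E>. F \<subseteq> E) \<and> card F = i}"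
  shows "f_ideal V I"
proof -
  have "squarefree_monomial_ideal V I"
    unfolding squarefree_monomial_ideal_def using sub I by blast
  moreover have "2 \<le> total_degree p" if "p \<in> minimal_generators V I" for p
  proof -
    have "minimal_generators V I = sqfree_monomial ` \<E>"
      using anti by (rule minimal_generators_eq)
    then obtain E where E: "E \<in> \<E>" "p = sqfree_monomial E"
      using \<open>p \<in> minimal_generators V I\<close> by blast
    then have "finite E"
      using sub finite_subset_V by blast
    then show ?thesis
      using deg[OF E(1)] E(2) by (simp add: total_degree_sqfree_monomial)
  qed
  moreover have "f_vector (stanley_reisner_complex V I) = f_vector (facet_complex V I)"
  proof (rule f_vector_cong)
    have fc: "facet_complex V I = {F. F \<subseteq> V \<and> (\<exists>E\<in>\<E>. F \<subseteq> E)}"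
      using anti by (rule facet_complex_eq)
    show "finite (stanley_reisner_complex V I)" "finite (facet_complex V I)"
      unfolding stanley_reisner_complex_eq fc using fin by simp_all
    show "card {F \<in> stanley_reisner_complex V I. card F = i}
        = card {F \<in> facet_complex V I. card F = i}" for i
      unfolding stanley_reisner_complex_eq fc using eq[of i] by simp
  qed
  ultimately show ?thesis
    using fin by (simp add: f_ideal_def)
qed

end

section \<open>Two cliques, one of them with an edge replaced by triples\<close>

locale two_cliques =
  fixes A B C :: "'v set" and a b :: 'v
  assumes fin: "finite A" "finite B" and disj: "A \<inter> B = {}"
    and ab: "a \<in> A" "b \<in> A" "a \<noteq> b" and C: "C \<subseteq> B"
    and cardA: "3 \<le> card A" and cardC: "2 * card C = card B"
    and cardAB: "card B = card A + 1 \<or> card A = card B + 2"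
begin

definition edges :: "'v set set" where
  "edges = {P. P \<subseteq> A \<and> card P = 2 \<and> P \<noteq> {a, b}} \<union> {P. P \<subseteq> B \<and> card P = 2}
     \<union> (\<lambda>c. {c, a, b}) ` C"

lemma edges_cases [consumes 1, case_names A B triple, cases set: edges]:
  assumes "E \<in> edges"
  obtains "E \<subseteq> A" "card E = 2" "E \<noteq> {a, b}" | "E \<subseteq> B" "card E = 2"
    | c where "c \<in> C" "E = {c, a, b}"
  using assms unfolding edges_def by blast

lemma pair_A: "u \<in> A \<Longrightarrow> v \<in> A \<Longrightarrow> u \<noteq> v \<Longrightarrow> {u, v} \<noteq> {a, b} \<Longrightarrow> {u, v} \<in> edges"
  by (auto simp: edges_def)

lemma pair_B: "u \<in> B \<Longrightarrow> v \<in> B \<Longrightarrow> u \<noteq> v \<Longrightarrow> {u, v} \<in> edges"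
  by (auto simp: edges_def)

lemma triple: "c \<in> C \<Longrightarrow> {c, a, b} \<in> edges"
  by (auto simp: edges_def)

lemma B_neq: "c \<in> B \<Longrightarrow> c \<noteq> a" "c \<in> B \<Longrightarrow> c \<noteq> b"
  using disj ab by auto

lemma card_triple: "c \<in> B \<Longrightarrow> card {c, a, b} = 3"
  using B_neq ab by simp

lemma edges_subset: "edges \<subseteq> Pow (A \<union> B)"
  using ab C by (auto elim!: edges_cases)

lemma two_le_card_edge: "E \<in> edges \<Longrightarrow> 2 \<le> card E"
  using card_triple C by (auto elim!: edges_cases)

lemma finite_edge: "E \<in> edges \<Longrightarrow> finite E"
  using two_le_card_edge[of E] card.infinite[of E] by fastforce

text \<open>
  Omitting \<open>{a, b}\<close> is what makes the triples minimal: it is the only pair of a triple that lies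
  in one of the two cliques.
\<close>

lemma edges_antichain:
  assumes "E \<in> edges" "F \<in> edges" "E \<subseteq> F"
  shows "E = F"
proof (cases "card E = card F")
  case True
  then show ?thesis
    using card_subset_eq[OF finite_edge[OF assms(2)] assms(3)] by simp
next
  case False
  then have less: "card E < card F"
    using card_mono[OF finite_edge[OF assms(2)] assms(3)] by simp
  from assms(2) obtain c where c: "c \<in> C" "F = {c, a, b}"
    using less two_le_card_edge[OF assms(1)] by cases auto
  have cB: "c \<in> B" "c \<notin> A"
    using c C disj by auto
  have E2: "card E = 2"
    using less two_le_card_edge[OF assms(1)] card_triple[OF cB(1)] c(2) by simp
  from assms(1) have False
  proof cases
    case A
    then have "E \<subseteq> {a, b}"
      using c(2) cB assms(3) by auto
    then have "E = {a, b}"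
      using E2 ab by (intro card_subset_eq) auto
    then show ?thesis
      using A by simp
  next
    case B
    then have "E \<subseteq> {c}"
      using c(2) ab disj assms(3) by auto
    then show ?thesis
      using E2 card_mono[of "{c}" E] by simp
  next
    case triple
    then show ?thesis
      using E2 card_triple C by auto
  qed
  then show ?thesis ..
qed

lemma
  shows C_nonempty: "\<exists>c. c \<in> C" and second_element_B: "\<exists>w\<in>B. w \<noteq> v"
proof -
  have pos: "0 < card C"
    using cardA cardC cardAB by linarith
  then have "C \<noteq> {}"
    by auto
  then show "\<exists>c. c \<in> C"
    by auto
  have "\<not> B \<subseteq> {v}"
    using card_mono[of "{v}" B] pos cardC by auto
  then show "\<exists>w\<in>B. w \<noteq> v"
    by auto
qed

lemma third_element_A: "\<exists>w\<in>A. w \<noteq> u \<and> w \<noteq> v"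
proof -
  have "card {u, v} \<le> 2"
    by (simp add: card_insert_if)
  then have "\<not> A \<subseteq> {u, v}"
    using card_mono[of "{u, v}" A] cardA by auto
  then show ?thesis
    by blast
qed

text \<open>
  The third element of \<open>A\<close> supplies pairs containing \<open>a\<close> and \<open>b\<close>. This is the statement that the
  facet complex has every vertex, as the Stanley-Reisner complex does.
\<close>

lemma vertex_in_edge:
  assumes "v \<in> A \<union> B"
  shows "\<exists>E\<in>edges. v \<in> E"
proof (cases "v \<in> A")
  case True
  obtain w where "w \<in> A" "w \<noteq> a" "w \<noteq> b"
    using third_element_A by blast
  show ?thesis
  proof (cases "v = w")
    case True
    then show ?thesis
      using pair_A[of a w] ab \<open>w \<in> A\<close> \<open>w \<noteq> a\<close> \<open>w \<noteq> b\<close> by (intro bexI[of _ "{a, w}"]) auto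
  next
    case False
    then show ?thesis
      using pair_A[of v w] \<open>v \<in> A\<close> \<open>w \<in> A\<close> \<open>w \<noteq> a\<close> \<open>w \<noteq> b\<close> by (intro bexI[of _ "{v, w}"]) auto
  qed
next
  case False
  then have "v \<in> B"
    using assms by simp
  then obtain w where "w \<in> B" "w \<noteq> v"
    using second_element_B by blast
  then show ?thesis
    using pair_B[of v w] \<open>v \<in> B\<close> by (intro bexI[of _ "{v, w}"]) auto
qed

text \<open>
  The faces with \<open>i\<close> elements: of the Stanley-Reisner complex in \<open>independent\<close>, of the facet complex
  in \<open>covered\<close>.
\<close>

definition independent :: "nat \<Rightarrow> 'v set set" where
  "independent i = {F. F \<subseteq> A \<union> B \<and> (\<forall>E\<in>edges. \<not> E \<subseteq> F) \<and> card F = i}"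

definition covered :: "nat \<Rightarrow> 'v set set" where
  "covered i = {F. F \<subseteq> A \<union> B \<and> (\<exists>E\<in>edges. F \<subseteq> E) \<and> card F = i}"

text \<open>
  A face of the Stanley-Reisner complex contains no pair of \<open>B\<close>, and the only pair of \<open>A\<close> it may
  contain is \<open>{a, b}\<close>. These two restrictions determine the faces of sizes 2 and 3 and exclude
  larger ones.
\<close>

lemma independent_inter_B:
  assumes "F \<in> independent i"
  obtains "F \<inter> B = {}" | d where "F \<inter> B = {d}" "d \<in> B"
proof -
  have "u = v" if "u \<in> F \<inter> B" "v \<in> F \<inter> B" for u v
  proof (rule ccontr)
    assume "u \<noteq> v"
    then have "{u, v} \<in> edges"
      using pair_B that by blast
    then show False
      using that assms by (auto simp: independent_def)
  qed
  then show thesis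
    using that by blast
qed

lemma independent_inter_A:
  assumes "F \<in> independent i"
  obtains "F \<inter> A = {}" | d where "F \<inter> A = {d}" "d \<in> A" | "F \<inter> A = {a, b}"
proof -
  have pair: "{u, v} = {a, b}" if "u \<in> F \<inter> A" "v \<in> F \<inter> A" "u \<noteq> v" for u v
  proof (rule ccontr)
    assume "{u, v} \<noteq> {a, b}"
    then have "{u, v} \<in> edges"
      using pair_A that by blast
    then show False
      using that assms by (auto simp: independent_def)
  qed
  show thesis
  proof (cases "\<exists>u v. u \<in> F \<inter> A \<and> v \<in> F \<inter> A \<and> u \<noteq> v")
    case True
    then have in_F: "a \<in> F \<inter> A" "b \<in> F \<inter> A"
      using pair by (metis insert_iff singletonD)+
    have "w \<in> {a, b}" if "w \<in> F \<inter> A" for w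
      using pair[OF that in_F(1)] by blast
    then show thesis
      using in_F that(3) by blast
  next
    case False
    then show thesis
      using that(1,2) by blast
  qed
qed

lemma independent_2:
  "independent 2 = insert {a, b} ((\<lambda>(u, v). {u, v}) ` (A \<times> B))"
proof (intro equalityI subsetI)
  fix F assume F: "F \<in> independent 2"
  have split: "F = (F \<inter> A) \<union> (F \<inter> B)" and c2: "card F = 2"
    using F by (auto simp: independent_def)
  from F show "F \<in> insert {a, b} ((\<lambda>(u, v). {u, v}) ` (A \<times> B))"
  proof (cases rule: independent_inter_A)
    case 1
    from F show ?thesis
      by (cases rule: independent_inter_B) (use 1 split c2 in auto)
  next
    case (2 u)
    from F show ?thesis
    proof (cases rule: independent_inter_B)
      case 1
      then show ?thesis
        using 2 split c2 by auto
    next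
      case (2 v)
      then have "F = {u, v}"
        using \<open>F \<inter> A = {u}\<close> split by blast
      then show ?thesis
        using \<open>u \<in> A\<close> 2 by auto
    qed
  next
    case 3
    then have "F = {a, b}"
      using card_subset_eq[of F "{a, b}"] c2 ab card_ge_0_finite[of F] by auto
    then show ?thesis
      by simp
  qed
next
  fix F assume "F \<in> insert {a, b} ((\<lambda>(u, v). {u, v}) ` (A \<times> B))"
  then consider "F = {a, b}" | u v where "F = {u, v}" "u \<in> A" "v \<in> B"
    by auto
  then show "F \<in> independent 2"
  proof cases
    case 1
    have False if E: "E \<in> edges" "E \<subseteq> {a, b}" for E
      using E(1)
    proof cases
      case A
      then show ?thesis
        using card_subset_eq[of "{a, b}" E] E(2) ab by simp
    next
      case B
      then have "E = {}"
        using E(2) ab disj by blast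
      then show ?thesis
        using B by simp
    next
      case (triple c)
      then show ?thesis
        using E(2) B_neq C by blast
    qed
    then show ?thesis
      using 1 ab by (auto simp: independent_def)
  next
    case (2 u v)
    have uv: "u \<noteq> v"
      using 2 disj by blast
    have False if E: "E \<in> edges" "E \<subseteq> {u, v}" for E
    proof -
      have "card E = 2 \<Longrightarrow> E = {u, v}"
        using card_subset_eq[of "{u, v}" E] E(2) uv by simp
      from E(1) this show False
      proof cases
        case (triple c)
        then have "c \<in> B"
          using C by blast
        then show ?thesis
          using triple E(2) card_mono[of "{u, v}" E] card_triple[of c] uv by simp
      qed (use 2 disj in auto)
    qed
    then show ?thesis
      using 2 uv by (auto simp: independent_def)
  qed
qed

lemma independent_3: "independent 3 = (\<lambda>d. {d, a, b}) ` (B - C)"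
proof (intro equalityI subsetI)
  fix F assume F: "F \<in> independent 3"
  have split: "F = (F \<inter> A) \<union> (F \<inter> B)" and c3: "card F = 3"
    using F by (auto simp: independent_def)
  have bound: "card F \<le> card (F \<inter> A) + card (F \<inter> B)"
    by (subst split) (rule card_Un_le)
  from F have "card (F \<inter> B) \<le> 1"
    by (cases rule: independent_inter_B) auto
  with bound c3 have "2 \<le> card (F \<inter> A)"
    by simp
  with F have FA: "F \<inter> A = {a, b}"
    by (cases rule: independent_inter_A) auto
  from F show "F \<in> (\<lambda>d. {d, a, b}) ` (B - C)"
  proof (cases rule: independent_inter_B)
    case 1
    then show ?thesis
      using bound c3 FA ab by simp
  next
    case (2 d)
    then have Fd: "F = {d, a, b}"
      using FA split by blast
    then have "d \<notin> C"
      using triple[of d] F by (auto simp: independent_def)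
    then show ?thesis
      using Fd 2 by blast
  qed
next
  fix F assume "F \<in> (\<lambda>d. {d, a, b}) ` (B - C)"
  then obtain d where d: "d \<in> B" "d \<notin> C" "F = {d, a, b}"
    by blast
  have dA: "d \<notin> A"
    using d disj by blast
  have False if E: "E \<in> edges" "E \<subseteq> {d, a, b}" for E
    using E(1)
  proof cases
    case A
    then have "E \<subseteq> {a, b}"
      using E(2) dA by blast
    then show ?thesis
      using card_subset_eq[of "{a, b}" E] A ab by simp
  next
    case B
    then have "E \<subseteq> {d}"
      using E(2) ab disj by blast
    then show ?thesis
      using card_mono[of "{d}" E] B by simp
  next
    case (triple c)
    then show ?thesis
      using E(2) d(2) B_neq C by blast
  qed
  then show "F \<in> independent 3"
    using d ab card_triple[of d] by (auto simp: independent_def)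
qed

lemma independent_ge_4:
  assumes "4 \<le> i"
  shows "independent i = {}"
proof (rule equals0I)
  fix F assume F: "F \<in> independent i"
  then have "F = (F \<inter> A) \<union> (F \<inter> B)" "card F = i"
    by (auto simp: independent_def)
  then have bound: "i \<le> card (F \<inter> A) + card (F \<inter> B)"
    by (metis card_Un_le)
  from F have "card (F \<inter> B) \<le> 1"
    by (cases rule: independent_inter_B) auto
  moreover from F have "card (F \<inter> A) \<le> 2"
    by (cases rule: independent_inter_A) (use ab in auto)
  ultimately show False
    using bound assms by simp
qed

text \<open>
  The pair \<open>{a, b}\<close> is not an edge, but lies in a triple because \<open>C\<close> is nonempty; so all pairs
  inside \<open>A\<close> occur.
\<close>

lemma covered_2:
  "covered 2 = {P. P \<subseteq> A \<and> card P = 2} \<union> {P. P \<subseteq> B \<and> card P = 2}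
     \<union> (\<lambda>(u, v). {u, v}) ` ({a, b} \<times> C)"
proof (intro equalityI subsetI)
  fix F assume "F \<in> covered 2"
  then obtain E where E: "E \<in> edges" "F \<subseteq> E" and c2: "card F = 2"
    by (auto simp: covered_def)
  from E(1) show "F \<in> {P. P \<subseteq> A \<and> card P = 2} \<union> {P. P \<subseteq> B \<and> card P = 2}
     \<union> (\<lambda>(u, v). {u, v}) ` ({a, b} \<times> C)"
  proof cases
    case (triple c)
    obtain u v where uv: "F = {u, v}" "u \<noteq> v"
      using c2 by (auto simp: card_2_iff)
    then consider "F = {a, b}" | "F = {a, c}" | "F = {b, c}"
      using triple E(2) by auto
    then show ?thesis
    proof cases
      case 1
      then show ?thesis
        using ab by auto
    qed (use triple in auto)
  qed (use E c2 in auto)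
next
  fix F assume "F \<in> {P. P \<subseteq> A \<and> card P = 2} \<union> {P. P \<subseteq> B \<and> card P = 2}
     \<union> (\<lambda>(u, v). {u, v}) ` ({a, b} \<times> C)"
  then consider "F = {a, b}" | "F \<subseteq> A" "card F = 2" "F \<noteq> {a, b}" | "F \<subseteq> B" "card F = 2"
    | u c where "F = {u, c}" "u \<in> {a, b}" "c \<in> C"
    by auto
  then show "F \<in> covered 2"
  proof cases
    case 1
    obtain c where "c \<in> C"
      using C_nonempty by blast
    then have "\<exists>E\<in>edges. F \<subseteq> E"
      using 1 triple by (intro bexI[of _ "{c, a, b}"]) auto
    then show ?thesis
      using 1 ab by (simp add: covered_def)
  next
    case (4 u c)
    then have "c \<noteq> u" "F \<subseteq> {c, a, b}" "{c, a, b} \<subseteq> A \<union> B"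
      using C B_neq ab by auto
    moreover from this have "\<exists>E\<in>edges. F \<subseteq> E"
      using 4 triple by (intro bexI[of _ "{c, a, b}"]) auto
    ultimately show ?thesis
      using 4 unfolding covered_def by auto
  qed (auto simp: covered_def edges_def)
qed

lemma covered_3: "covered 3 = (\<lambda>c. {c, a, b}) ` C"
proof (intro equalityI subsetI)
  fix F assume "F \<in> covered 3"
  then obtain E where E: "E \<in> edges" "F \<subseteq> E" and c3: "card F = 3"
    by (auto simp: covered_def)
  have le: "3 \<le> card E"
    using card_mono[OF finite_edge[OF E(1)] E(2)] c3 by simp
  from E(1) show "F \<in> (\<lambda>c. {c, a, b}) ` C"
  proof cases
    case (triple c)
    then have "F = E"
      using card_subset_eq[OF finite_edge[OF E(1)] E(2)] c3 card_triple[of c] C by auto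
    then show ?thesis
      using triple by blast
  qed (use le in auto)
next
  fix F assume "F \<in> (\<lambda>c. {c, a, b}) ` C"
  then obtain c where "c \<in> C" "F = {c, a, b}"
    by blast
  then show "F \<in> covered 3"
    using triple[of c] edges_subset card_triple[of c] C by (auto simp: covered_def)
qed

lemma covered_ge_4:
  assumes "4 \<le> i"
  shows "covered i = {}"
proof (rule equals0I)
  fix F assume "F \<in> covered i"
  then obtain E where E: "E \<in> edges" "F \<subseteq> E" and ci: "card F = i"
    by (auto simp: covered_def)
  have "4 \<le> card E"
    using card_mono[OF finite_edge[OF E(1)] E(2)] ci assms by simp
  with E(1) show False
    by cases (use card_triple C in auto)
qed

lemma independent_eq_covered_0: "independent 0 = covered 0"
proof -
  obtain c where "c \<in> C"
    using C_nonempty by blast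
  then have "edges \<noteq> {}"
    using triple by blast
  moreover have "F = {}" if "F \<subseteq> A \<union> B" "card F = 0" for F
    using that fin by (metis card_0_eq finite_UnI finite_subset)
  moreover have "E \<noteq> {}" if "E \<in> edges" for E
    using two_le_card_edge[OF that] by auto
  ultimately have "independent 0 = {{}}" "covered 0 = {{}}"
    unfolding independent_def covered_def by auto
  then show ?thesis
    by simp
qed

lemma independent_eq_covered_1: "independent 1 = covered 1"
proof -
  have "\<not> E \<subseteq> F" if "E \<in> edges" "card F = 1" for E F
    using that two_le_card_edge[of E] card_mono[of F E] card_ge_0_finite[of F] by auto
  moreover have "\<exists>E\<in>edges. F \<subseteq> E" if "F \<subseteq> A \<union> B" "card F = 1" for F
    using that vertex_in_edge by (auto simp: card_1_singleton_iff)
  ultimately show ?thesis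
    unfolding independent_def covered_def by blast
qed

lemma inj_on_cross_pairs: "inj_on (\<lambda>(u, v). {u, v}) (A \<times> B)"
proof (rule inj_onI, clarify)
  fix u v u' v'
  assume "u \<in> A" "v \<in> B" "u' \<in> A" "v' \<in> B" "{u, v} = {u', v'}"
  moreover from this have "u \<noteq> v'"
    using disj by blast
  ultimately show "u = u' \<and> v = v'"
    by (simp add: doubleton_eq_iff)
qed

lemma inj_on_triples: "inj_on (\<lambda>d. {d, a, b}) B"
proof (rule inj_onI)
  fix d e assume "d \<in> B" "{d, a, b} = {e, a, b}"
  then show "d = e"
    using B_neq[of d] by blast
qed

lemma card_independent_2: "card (independent 2) = card A * card B + 1"
proof -
  have "{a, b} \<notin> (\<lambda>(u, v). {u, v}) ` (A \<times> B)"
    using ab disj by (fastforce simp: doubleton_eq_iff)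
  then show ?thesis
    unfolding independent_2
    using fin card_image[OF inj_on_cross_pairs] by (simp add: card_cartesian_product)
qed

lemma card_covered_2: "card (covered 2) = (card A choose 2) + (card B choose 2) + card B"
proof -
  let ?PA = "{P. P \<subseteq> A \<and> card P = 2}" and ?PB = "{P. P \<subseteq> B \<and> card P = 2}"
  let ?M = "(\<lambda>(u, v). {u, v}) ` ({a, b} \<times> C)"
  have finC: "finite C"
    using C fin finite_subset by blast
  have "{a, b} \<times> C \<subseteq> A \<times> B"
    using ab C by blast
  then have "inj_on (\<lambda>(u, v). {u, v}) ({a, b} \<times> C)"
    by (rule inj_on_subset[OF inj_on_cross_pairs])
  then have "card ?M = card ({a, b} \<times> C)"
    by (rule card_image)
  then have M: "card ?M = card B"
    using ab cardC by (simp add: card_cartesian_product)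
  have "?PA \<inter> ?PB = {}"
  proof (rule equals0I)
    fix P assume P: "P \<in> ?PA \<inter> ?PB"
    then have "P = {}"
      using disj by blast
    then show False
      using P by simp
  qed
  moreover have "(?PA \<union> ?PB) \<inter> ?M = {}"
  proof (rule equals0I)
    fix P assume P: "P \<in> (?PA \<union> ?PB) \<inter> ?M"
    then obtain u c where uc: "P = {u, c}" "u \<in> {a, b}" "c \<in> C"
      by (elim IntE imageE SigmaE) simp
    have "c \<notin> A" "u \<notin> B"
      using uc(2,3) ab C disj by blast+
    then show False
      using P by (simp add: uc(1))
  qed
  moreover have "finite ?PA" "finite ?PB" "finite ?M"
    using fin finC by simp_all
  ultimately have "card (?PA \<union> ?PB \<union> ?M) = card ?PA + card ?PB + card ?M"
    by (simp add: card_Un_disjoint)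
  then show ?thesis
    unfolding covered_2 using fin M by (simp add: n_subsets)
qed

text \<open>
  The left side counts the two-element faces of the Stanley-Reisner complex, the right side those of
  the facet complex. Doubling clears the binomial coefficients; the difference of the two sides then
  becomes \<open>d (d - 1) - 2\<close> with \<open>d = card A - card B\<close>, which vanishes for \<open>d = -1\<close> and \<open>d = 2\<close>.
\<close>

lemma cross_pairs_count: "card A * card B + 1 = (card A choose 2) + (card B choose 2) + card B"
proof -
  have choose2: "2 * (Suc n choose 2) = Suc n * n" for n :: nat
    by (induction n) (simp_all add: numeral_2_eq_2)
  obtain n where n: "card A = Suc n"
    using cardA by (cases "card A") auto
  have "2 * (card A * card B + 1) = 2 * ((card A choose 2) + (card B choose 2) + card B)"
    using cardAB
  proof
    assume "card B = card A + 1"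
    then show ?thesis
      using choose2[of n] choose2[of "Suc n"] by (simp add: n algebra_simps)
  next
    assume AB: "card A = card B + 2"
    then obtain p where "card B = Suc p"
      using cardA by (cases "card B") auto
    then show ?thesis
      using choose2[of p] choose2[of "Suc (Suc p)"] AB by (simp add: algebra_simps)
  qed
  then show ?thesis
    by simp
qed

lemma card_independent_eq_card_covered: "card (independent i) = card (covered i)"
proof -
  have "i = 0 \<or> i = 1 \<or> i = 2 \<or> i = 3 \<or> 4 \<le> i"
    by linarith
  moreover have "card (independent 2) = card (covered 2)"
    unfolding card_independent_2 card_covered_2 by (rule cross_pairs_count)
  moreover have "card (independent 3) = card (covered 3)"
  proof -
    have "inj_on (\<lambda>d. {d, a, b}) S" if "S \<subseteq> B" for S
      using inj_on_subset[OF inj_on_triples that] .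
    then show ?thesis
      unfolding independent_3 covered_3
      using C cardC fin by (simp add: card_image card_Diff_subset finite_subset)
  qed
  ultimately show ?thesis
    using independent_eq_covered_0 independent_eq_covered_1 independent_ge_4 covered_ge_4 by auto
qed

lemma f_ideal_edges:
  "f_ideal (A \<union> B) (Idl\<^bsub>mpoly_ring (A \<union> B)\<^esub> (sqfree_monomial ` edges :: ('v, 'a::field) mpoly set))"
proof (rule f_ideal_if_card_eq[OF _ edges_subset refl])
  show "finite (A \<union> B)"
    using fin by simp
  show "card {F. F \<subseteq> A \<union> B \<and> (\<forall>E\<in>edges. \<not> E \<subseteq> F) \<and> card F = i}
      = card {F. F \<subseteq> A \<union> B \<and> (\<exists>E\<in>edges. F \<subseteq> E) \<and> card F = i}" for i
    using card_independent_eq_card_covered by (simp add: independent_def covered_def)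
  show "E = F" if "E \<in> edges" "F \<in> edges" "E \<subseteq> F" for E F
    using that by (rule edges_antichain)
  show "2 \<le> card E" if "E \<in> edges" for E
    using that by (rule two_le_card_edge)
qed

end

section \<open>Translation to products of variables\<close>

lemma sqfree_monomial_pair: "u \<noteq> v \<Longrightarrow> sqfree_monomial {u, v} = indet u * indet v"
  by (simp add: sqfree_monomial_def)

lemma sqfree_monomial_pairs:
  "{indet u * indet v | u v. u \<in> S \<and> v \<in> S \<and> u \<noteq> v} = sqfree_monomial ` {P. P \<subseteq> S \<and> card P = 2}"
proof (intro equalityI subsetI)
  fix p :: "('a, 'b) mpoly"
  assume "p \<in> {indet u * indet v | u v. u \<in> S \<and> v \<in> S \<and> u \<noteq> v}"
  then obtain u v where "u \<in> S" "v \<in> S" "u \<noteq> v" "p = indet u * indet v"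
    by blast
  then show "p \<in> sqfree_monomial ` {P. P \<subseteq> S \<and> card P = 2}"
    by (intro image_eqI[of _ _ "{u, v}"]) (simp_all add: sqfree_monomial_pair)
next
  fix p :: "('a, 'b) mpoly"
  assume "p \<in> sqfree_monomial ` {P. P \<subseteq> S \<and> card P = 2}"
  then obtain u v where "u \<in> S" "v \<in> S" "u \<noteq> v" "p = sqfree_monomial {u, v}"
    by (auto simp: card_2_iff)
  then show "p \<in> {indet u * indet v | u v. u \<in> S \<and> v \<in> S \<and> u \<noteq> v}"
    by (auto simp: sqfree_monomial_pair)
qed

text \<open>
  The set \<open>T\<close> of cubic generators is given only as a set of polynomials. An injective choice of
  preimages recovers \<open>C\<close> with the same number of elements.
\<close>

proposition f_ideal_two_cliques:
  fixes A B :: "'v set" and T :: "('v, 'a::field) mpoly set"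
  assumes fin: "finite A" "finite B" and disj: "A \<inter> B = {}"
    and ab: "a \<in> A" "b \<in> A" "a \<noteq> b"
    and T: "T \<subseteq> (\<lambda>c. indet c * indet a * indet b) ` B" "2 * card T = card B"
    and cardA: "3 \<le> card A" and cardAB: "card B = card A + 1 \<or> card A = card B + 2"
  shows "f_ideal (A \<union> B) (Idl\<^bsub>mpoly_ring (A \<union> B)\<^esub>
    (({indet u * indet v | u v. u \<in> A \<and> v \<in> A \<and> u \<noteq> v} - {indet a * indet b})
      \<union> {indet u * indet v | u v. u \<in> B \<and> v \<in> B \<and> u \<noteq> v} \<union> T))"
proof -
  obtain C where C: "C \<subseteq> B" "inj_on (\<lambda>c. indet c * indet a * indet b :: ('v, 'a) mpoly) C"
    and TC: "T = (\<lambda>c. indet c * indet a * indet b) ` C"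
    using T(1) unfolding subset_image_inj by blast
  interpret two_cliques A B C a b
    using assms C card_image[OF C(2)] by unfold_locales (simp_all add: TC)
  have "sqfree_monomial ` {P. P \<subseteq> A \<and> card P = 2} - {indet a * indet b :: ('v, 'a) mpoly}
      = sqfree_monomial ` {P. P \<subseteq> A \<and> card P = 2} - sqfree_monomial ` {{a, b}}"
    by (simp add: sqfree_monomial_pair[OF ab(3)])
  also have "\<dots> = sqfree_monomial ` ({P. P \<subseteq> A \<and> card P = 2} - {{a, b}})"
  proof (rule inj_on_image_set_diff[symmetric, of _ "Pow A"])
    show "inj_on (sqfree_monomial :: 'v set \<Rightarrow> ('v, 'a) mpoly) (Pow A)"
      using sqfree_monomial_inject fin(1) finite_subset unfolding inj_on_def by (metis PowD)
  qed (use ab in auto)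
  also have "{P. P \<subseteq> A \<and> card P = 2} - {{a, b}} = {P. P \<subseteq> A \<and> card P = 2 \<and> P \<noteq> {a, b}}"
    by blast
  finally have pairs: "sqfree_monomial ` {P. P \<subseteq> A \<and> card P = 2} - {indet a * indet b :: ('v, 'a) mpoly}
      = sqfree_monomial ` {P. P \<subseteq> A \<and> card P = 2 \<and> P \<noteq> {a, b}}" .
  have "sqfree_monomial {c, a, b} = (indet c * indet a * indet b :: ('v, 'a) mpoly)" if "c \<in> C" for c
    using that B_neq[of c] C(1) ab by (auto simp: sqfree_monomial_def mult.assoc)
  then have "T = sqfree_monomial ` (\<lambda>c. {c, a, b}) ` C"
    unfolding TC image_image by simp
  then show ?thesis
    using f_ideal_edges unfolding edges_def image_Un sqfree_monomial_pairs pairs by simp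
qed

theorem theorem4p10:
  shows
    "(\<forall>(k::nat) (l::nat) (m::nat) V (G1 :: (xy_var, 'a::field) mpoly set) G2 G3.
        k \<ge> 3 \<and> odd k \<and> l \<in> {1..k} \<and> m \<in> {1..k} \<and> l \<noteq> m \<and>
        V = X ` {1..k} \<union> Y ` {1..k+1} \<and>
        G1 = {x i * x j | i j. i \<in> {1..k} \<and> j \<in> {1..k} \<and> i \<noteq> j} - {x l * x m} \<and>
        G2 = {y i * y j | i j. i \<in> {1..k+1} \<and> j \<in> {1..k+1} \<and> i \<noteq> j} \<and>
        G3 \<subseteq> {y i * x l * x m | i. i \<in> {1..k+1}} \<and> card G3 = (k + 1) div 2
        \<longrightarrow> f_ideal V (Idl\<^bsub>mpoly_ring V\<^esub> (G1 \<union> G2 \<union> G3)))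
     \<and>
     (\<forall>(k::nat) (l::nat) (m::nat) V (G1 :: (xy_var, 'a::field) mpoly set) G2 G3.
        k \<ge> 4 \<and> even k \<and> l \<in> {1..k+2} \<and> m \<in> {1..k+2} \<and> l \<noteq> m \<and>
        V = X ` {1..k} \<union> Y ` {1..k+2} \<and>
        G1 = {x i * x j | i j. i \<in> {1..k} \<and> j \<in> {1..k} \<and> i \<noteq> j} \<and>
        G2 = {y i * y j | i j. i \<in> {1..k+2} \<and> j \<in> {1..k+2} \<and> i \<noteq> j} - {y l * y m} \<and>
        G3 \<subseteq> {x i * y l * y m | i. i \<in> {1..k}} \<and> card G3 = k div 2
        \<longrightarrow> f_ideal V (Idl\<^bsub>mpoly_ring V\<^esub> (G1 \<union> G2 \<union> G3)))"
proof (intro conjI allI impI; elim conjE)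
  fix k l m :: nat and V and G1 G2 G3 :: "(xy_var, 'a::field) mpoly set"
  assume k: "k \<ge> 3" "odd k" and lm: "l \<in> {1..k}" "m \<in> {1..k}" "l \<noteq> m"
    and V: "V = X ` {1..k} \<union> Y ` {1..k+1}"
    and G1: "G1 = {x i * x j | i j. i \<in> {1..k} \<and> j \<in> {1..k} \<and> i \<noteq> j} - {x l * x m}"
    and G2: "G2 = {y i * y j | i j. i \<in> {1..k+1} \<and> j \<in> {1..k+1} \<and> i \<noteq> j}"
    and G3: "G3 \<subseteq> {y i * x l * x m | i. i \<in> {1..k+1}}" "card G3 = (k + 1) div 2"
  have card: "card (X ` S) = card S" "card (Y ` S) = card S" for S
    by (simp_all add: card_image inj_on_def)
  have "G1 = {indet u * indet v | u v. u \<in> X ` {1..k} \<and> v \<in> X ` {1..k} \<and> u \<noteq> v} - {x l * x m}"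
    unfolding G1 by (intro arg_cong2[of _ _ _ _ "(-)"] refl) blast
  moreover have "G2 = {indet u * indet v | u v. u \<in> Y ` {1..k+1} \<and> v \<in> Y ` {1..k+1} \<and> u \<noteq> v}"
    unfolding G2 by blast
  moreover have "G3 \<subseteq> (\<lambda>c. indet c * x l * x m) ` Y ` {1..k+1}"
    using G3(1) by blast
  ultimately show "f_ideal V (Idl\<^bsub>mpoly_ring V\<^esub> (G1 \<union> G2 \<union> G3))"
    unfolding V using k lm G3(2)
    by (simp only:) (rule f_ideal_two_cliques, auto simp: card)
next
  fix k l m :: nat and V and G1 G2 G3 :: "(xy_var, 'a::field) mpoly set"
  assume k: "k \<ge> 4" "even k" and lm: "l \<in> {1..k+2}" "m \<in> {1..k+2}" "l \<noteq> m"
    and V: "V = X ` {1..k} \<union> Y ` {1..k+2}"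
    and G1: "G1 = {x i * x j | i j. i \<in> {1..k} \<and> j \<in> {1..k} \<and> i \<noteq> j}"
    and G2: "G2 = {y i * y j | i j. i \<in> {1..k+2} \<and> j \<in> {1..k+2} \<and> i \<noteq> j} - {y l * y m}"
    and G3: "G3 \<subseteq> {x i * y l * y m | i. i \<in> {1..k}}" "card G3 = k div 2"
  have card: "card (X ` S) = card S" "card (Y ` S) = card S" for S
    by (simp_all add: card_image inj_on_def)
  have swap: "V = Y ` {1..k+2} \<union> X ` {1..k}" "G1 \<union> G2 \<union> G3 = G2 \<union> G1 \<union> G3"
    unfolding V by blast+
  have "G2 = {indet u * indet v | u v. u \<in> Y ` {1..k+2} \<and> v \<in> Y ` {1..k+2} \<and> u \<noteq> v} - {y l * y m}"
    unfolding G2 by (intro arg_cong2[of _ _ _ _ "(-)"] refl) blast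
  moreover have "G1 = {indet u * indet v | u v. u \<in> X ` {1..k} \<and> v \<in> X ` {1..k} \<and> u \<noteq> v}"
    unfolding G1 by blast
  moreover have "G3 \<subseteq> (\<lambda>c. indet c * y l * y m) ` X ` {1..k}"
    using G3(1) by blast
  ultimately show "f_ideal V (Idl\<^bsub>mpoly_ring V\<^esub> (G1 \<union> G2 \<union> G3))"
    unfolding swap using k lm G3(2)
    by (simp only:) (rule f_ideal_two_cliques, auto simp: card)
qed

end
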